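(* Let $\mathcal{C}$ denote the set of cylindric partitions $\Lambda=(\lambda^{(1)},\lambda^{(2)})$ of profile $(1,1)$, written as pairs $$P_k=[\lambda^{(2)}_k,\lambda^{(1)}_k]=[b_k,a_k],\qquad 1\le k\le N,\qquad N=\max\{\ell(\lambda^{(1)}),\ell(\lambda^{(2)})\},$$ with zeros appended to the shorter component when necessary, such that $a_k-b_k\in\{0,1\}$ for every $k$, and such that, writing $$J(\Lambda)=\{k: a_k=b_k+1\},\qquad S_k=\#\{j>k: j\in J(\Lambda)\},\qquad r_k=b_k-S_k,$$ there exists an integer $t$ with $0\le t\le N$ such that $$r_1>r_2>\cdots>r_t>0\qquad\text{and}\qquad r_k=0\ \text{ for } t<k\le N,$$ where the first condition is vacuous when $t=0$. Let $\mathcal{P}$ denote the set of pairs $(\mu,\beta)$ of partitions such that every positive part occurring in $\mu$ has multiplicity exactly two, and $\beta$ is a partition into distinct odd parts. Then there is a weight-preserving bijection $\Phi:\mathcal{C}\to\mathcal{P}$, that is, a bijection such that $|\Lambda|=|\mu|+|\beta|$ whenever $\Phi(\Lambda)=(\mu,\beta)$.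
   Context: A cylindric partition of profile $(1,1)$ is a pair $\Lambda=(\lambda^{(1)},\lambda^{(2)})$ of integer partitions (weakly decreasing finite sequences of positive integers, missing entries regarded as $0$) such that $\lambda^{(1)}_j\ge\lambda^{(2)}_{j+1}$ and $\lambda^{(2)}_j\ge\lambda^{(1)}_{j+1}$ for all $j\ge1$. $|\Lambda|$ is the sum of all parts of $\lambda^{(1)}$ and $\lambda^{(2)}$; $|\mu|,|\beta|$ are the sums of the parts of the partitions $\mu,\beta$; $\ell(\lambda)$ is the number of positive parts of a partition $\lambda$. Empty partitions are allowed. *)

theory Defs
  imports Main
begin

definition is_partition :: "nat list \<Rightarrow> bool" where
  "is_partition xs \<longleftrightarrow> sorted_wrt (\<ge>) xs \<and> (\<forall>x\<in>set xs. 0 < x)"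

text \<open>Parts are indexed from 1; missing parts are 0.\<close>

definition part :: "nat list \<Rightarrow> nat \<Rightarrow> nat" where
  "part xs j = (if 1 \<le> j \<and> j \<le> length xs then xs ! (j - 1) else 0)"

definition cylindric_partition_11 :: "nat list \<times> nat list \<Rightarrow> bool" where
  "cylindric_partition_11 = (\<lambda>(l1, l2). is_partition l1 \<and> is_partition l2 \<and>
     (\<forall>j\<ge>1. part l1 j \<ge> part l2 (j + 1) \<and> part l2 j \<ge> part l1 (j + 1)))"

definition weight :: "nat list \<times> nat list \<Rightarrow> nat" where
  "weight = (\<lambda>(l1, l2). sum_list l1 + sum_list l2)"

definition num_pairs :: "nat list \<times> nat list \<Rightarrow> nat" where
  "num_pairs = (\<lambda>(l1, l2). max (length l1) (length l2))"

text \<open>The k-th pair is \<open>[b\<^sub>k, a\<^sub>k]\<close>, where \<open>a\<close> comes from the first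
  partition and \<open>b\<close> from the second. The entries are integers, so that
  \<open>b\<^sub>k - S\<^sub>k\<close> is not truncated at 0.\<close>

definition a_entry :: "nat list \<times> nat list \<Rightarrow> nat \<Rightarrow> int" where
  "a_entry L k = int (part (fst L) k)"

definition b_entry :: "nat list \<times> nat list \<Rightarrow> nat \<Rightarrow> int" where
  "b_entry L k = int (part (snd L) k)"

definition J_set :: "nat list \<times> nat list \<Rightarrow> nat set" where
  "J_set L = {k \<in> {1..num_pairs L}. a_entry L k = b_entry L k + 1}"

definition S_count :: "nat list \<times> nat list \<Rightarrow> nat \<Rightarrow> nat" where
  "S_count L k = card {j \<in> J_set L. k < j}"

definition r_entry :: "nat list \<times> nat list \<Rightarrow> nat \<Rightarrow> int" where
  "r_entry L k = b_entry L k - int (S_count L k)"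

definition C_set :: "(nat list \<times> nat list) set" where
  "C_set = {L. cylindric_partition_11 L \<and>
     (\<forall>k\<in>{1..num_pairs L}. a_entry L k - b_entry L k \<in> {0, 1}) \<and>
     (\<exists>t\<le>num_pairs L.
        (\<forall>k\<in>{1..<t}. r_entry L k > r_entry L (k + 1)) \<and>
        (1 \<le> t \<longrightarrow> r_entry L t > 0) \<and>
        (\<forall>k. t < k \<and> k \<le> num_pairs L \<longrightarrow> r_entry L k = 0))}"

definition P_set :: "(nat list \<times> nat list) set" where
  "P_set = {(\<mu>, \<beta>). is_partition \<mu> \<and> (\<forall>x\<in>set \<mu>. count_list \<mu> x = 2) \<and>
     is_partition \<beta> \<and> distinct \<beta> \<and> (\<forall>x\<in>set \<beta>. odd x)}"

end

(* Summing over k, each j in J contributes to exactly the j - 1 numbers S_k with k < j, so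
     |Lambda| = sum_k (2 b_k + [k in J]) = 2 (r_1 + ... + r_t) + sum_{j in J} (2 j - 1).
   Hence mu contains every r_k > 0 twice and beta consists of the parts 2 j - 1 with j in J.
   Conversely, a strict partition r and a finite set J of positive integers determine Lambda by
   b_k = r_k + S_k and a_k = b_k + [k in J]; the inequality b_k >= a_{k+1} amounts to
   r_k >= r_{k+1}, because S_k = S_{k+1} + [k+1 in J]. The set J is stored as a strict
   partition too, so that both C and P are in bijection with pairs of strict partitions. *)

theory Submission
  imports Defs
begin

section \<open>Partitions and their part functions\<close>

lemma is_partition_Cons:
  "is_partition (x # xs) \<longleftrightarrow> 0 < x \<and> (\<forall>y\<in>set xs. y \<le> x) \<and> is_partition xs"
  by (auto simp: is_partition_def)

lemma part_pos_iff:
  assumes "is_partition xs" "1 \<le> k"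
  shows "0 < part xs k \<longleftrightarrow> k \<le> length xs"
  using assms by (auto simp: part_def is_partition_def)

lemma partition_eqI:
  assumes "is_partition xs" "is_partition ys" "\<And>k. 1 \<le> k \<Longrightarrow> part xs k = part ys k"
  shows "xs = ys"
proof (rule nth_equalityI)
  have "k \<le> length xs \<longleftrightarrow> k \<le> length ys" if "1 \<le> k" for k
    using assms part_pos_iff that by metis
  then show len: "length xs = length ys"
    by (metis One_nat_def Suc_leI le_antisym le_refl length_greater_0_conv linorder_not_le list.size(3) not_less_zero)
  fix i assume "i < length xs"
  then show "xs ! i = ys ! i"
    using assms(3)[of "Suc i"] len by (simp add: part_def)
qed

lemma part_antimono:
  assumes "is_partition xs" "1 \<le> i" "i \<le> j"
  shows "part xs j \<le> part xs i"
proof (cases "i = j \<or> length xs < j")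
  case False
  then show ?thesis
    using assms sorted_wrt_nth_less[of "(\<ge>)" xs "i - 1" "j - 1"]
    by (auto simp: part_def is_partition_def)
qed (use assms in \<open>auto simp: part_def\<close>)

definition list_of_parts :: "(nat \<Rightarrow> nat) \<Rightarrow> nat list" where
  "list_of_parts f = map f [1..<Suc (card {k. 1 \<le> k \<and> 0 < f k})]"

lemma list_of_parts:
  fixes f :: "nat \<Rightarrow> nat"
  assumes mono: "\<And>k. 1 \<le> k \<Longrightarrow> f (Suc k) \<le> f k" and fin: "\<And>k. N < k \<Longrightarrow> f k = 0"
  shows "is_partition (list_of_parts f)"
    and "1 \<le> k \<Longrightarrow> part (list_of_parts f) k = f k"
proof -
  have anti: "f j \<le> f i" if "1 \<le> i" "i \<le> j" for i j
    using that(2,1)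
  proof (induction rule: dec_induct)
    case (step n)
    then show ?case using mono[of n] by linarith
  qed simp
  define A where "A = {k. 1 \<le> k \<and> 0 < f k}"
  have "finite A"
    by (rule finite_subset[of _ "{..N}"]) (use fin in \<open>force simp: A_def intro: leI\<close>, simp)
  have A: "A = {1..card A}"
  proof (cases "A = {}")
    case False
    have "A = {1..Max A}"
    proof
      show "A \<subseteq> {1..Max A}" using \<open>finite A\<close> by (auto simp: A_def)
      have "Max A \<in> A" using \<open>finite A\<close> False by (rule Max_in)
      then show "{1..Max A} \<subseteq> A" using anti unfolding A_def by fastforce
    qed
    then show ?thesis by (metis card_atLeastAtMost diff_Suc_1)
  qed simp
  have pos: "0 < f k \<longleftrightarrow> k \<le> card A" if "1 \<le> k" for k
  proof -
    have "k \<in> A \<longleftrightarrow> k \<in> {1..card A}" by (rule arg_cong[OF A])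
    then show ?thesis using that by (simp add: A_def)
  qed
  have L: "list_of_parts f = map f [1..<Suc (card A)]"
    by (simp add: list_of_parts_def A_def)
  show "is_partition (list_of_parts f)"
    unfolding is_partition_def L
    by (auto simp: sorted_wrt_iff_nth_less anti pos simp del: upt_Suc)
  show "part (list_of_parts f) k = f k" if "1 \<le> k"
    using pos[OF that] that unfolding L by (auto simp: part_def simp del: upt_Suc)
qed

lemma sum_list_eq_sum_part:
  assumes "length xs \<le> N"
  shows "sum_list xs = (\<Sum>k=1..N. part xs k)"
proof -
  have "sum_list xs = (\<Sum>i<length xs. xs ! i)"
    by (simp add: sum_list_sum_nth atLeast0LessThan)
  also have "\<dots> = (\<Sum>i<length xs. part xs (Suc i))"
    by (simp add: part_def)
  also have "\<dots> = (\<Sum>k=1..length xs. part xs k)"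
    by (simp add: sum.atLeast1_atMost_eq)
  also have "\<dots> = (\<Sum>k=1..N. part xs k)"
    by (rule sum.mono_neutral_left) (use assms in \<open>auto simp: part_def\<close>)
  finally show ?thesis .
qed

definition strict_partition :: "nat list \<Rightarrow> bool" where
  "strict_partition xs \<longleftrightarrow> sorted_wrt (>) xs \<and> 0 \<notin> set xs"

lemma strict_partition_imp_is_partition: "strict_partition xs \<Longrightarrow> is_partition xs"
  unfolding strict_partition_def is_partition_def
  by (metis gr0I order_less_imp_le sorted_wrt_mono_rel)

lemma strict_partition_distinct: "strict_partition xs \<Longrightarrow> distinct xs"
  unfolding strict_partition_def by (induction xs) auto

lemma strict_partition_eqI:
  assumes "strict_partition xs" "strict_partition ys" "set xs = set ys"
  shows "xs = ys"
proof -
  have "rev xs = rev ys"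
    by (rule strict_sorted_equal) (use assms in \<open>auto simp: strict_partition_def sorted_wrt_rev\<close>)
  then show ?thesis by simp
qed

lemma strict_partition_rev_sorted_list_of_set:
  assumes "finite A" "0 \<notin> A"
  shows "strict_partition (rev (sorted_list_of_set A))"
  using assms strict_sorted_list_of_set[of A]
  by (simp add: strict_partition_def sorted_wrt_rev)

lemma sum_list_strict_partition:
  assumes "strict_partition ys"
  shows "sum_list (map f ys) = sum f (set ys)"
  using assms by (simp add: strict_partition_distinct sum_list_distinct_conv_sum_set)

definition strict_pairs :: "(nat list \<times> nat list) set" where
  "strict_pairs = {(xs, ys). strict_partition xs \<and> strict_partition ys}"

section \<open>Pairs of strict partitions and \<open>P_set\<close>\<close>

definition duplicate :: "nat list \<Rightarrow> nat list" where
  "duplicate xs = concat (map (\<lambda>x. [x, x]) xs)"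

definition to_P :: "nat list \<times> nat list \<Rightarrow> nat list \<times> nat list" where
  "to_P = (\<lambda>(xs, ys). (duplicate xs, map (\<lambda>j. 2 * j - 1) ys))"

lemma set_duplicate [simp]: "set (duplicate xs) = set xs"
  by (auto simp: duplicate_def)

lemma sum_list_duplicate: "sum_list (duplicate xs) = 2 * sum_list xs"
  by (induction xs) (auto simp: duplicate_def)

lemma count_list_duplicate: "count_list (duplicate xs) x = 2 * count_list xs x"
  by (induction xs) (auto simp: duplicate_def)

lemma is_partition_duplicate: "is_partition xs \<Longrightarrow> is_partition (duplicate xs)"
proof (induction xs)
  case (Cons x xs)
  moreover have "duplicate (x # xs) = x # x # duplicate xs" by (simp add: duplicate_def)
  ultimately show ?case by (simp add: is_partition_Cons)
qed (simp add: duplicate_def)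

lemma count_list_distinct:
  "distinct xs \<Longrightarrow> count_list xs x = (if x \<in> set xs then 1 else 0)"
  by (induction xs) auto

lemma is_partition_eqI_count:
  assumes "is_partition xs" "is_partition ys" "\<And>x. count_list xs x = count_list ys x"
  shows "xs = ys"
  using assms
proof (induction xs arbitrary: ys)
  case Nil
  then have "x \<notin> set ys" for x by (simp flip: count_list_0_iff)
  then show ?case by (cases ys) auto
next
  case (Cons x xs)
  have sets: "set (x # xs) = set ys"
    using Cons.prems(3) by (intro set_eqI) (metis count_list_0_iff)
  then obtain y ys' where ys: "ys = y # ys'" by (cases ys) auto
  have "y \<in> set (x # xs)" "x \<in> set ys" using sets ys by auto
  then have "x = y"
    using Cons.prems(1,2) unfolding ys by (auto simp: is_partition_Cons intro: antisym)
  moreover have "count_list xs z = count_list ys' z" for z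
    using Cons.prems(3)[of z] by (simp add: ys \<open>x = y\<close> split: if_splits)
  ultimately show ?case
    using Cons.IH[of ys'] Cons.prems(1,2) by (simp add: ys is_partition_Cons)
qed

lemma duplicate_surj:
  assumes "is_partition \<mu>" "\<forall>x\<in>set \<mu>. count_list \<mu> x = 2"
  obtains xs where "strict_partition xs" "duplicate xs = \<mu>"
proof
  let ?xs = "rev (sorted_list_of_set (set \<mu>))"
  show strict: "strict_partition ?xs"
    using assms(1) by (intro strict_partition_rev_sorted_list_of_set) (auto simp: is_partition_def)
  show "duplicate ?xs = \<mu>"
  proof (rule is_partition_eqI_count)
    show "is_partition (duplicate ?xs)"
      using strict by (intro is_partition_duplicate strict_partition_imp_is_partition)
    show "count_list (duplicate ?xs) x = count_list \<mu> x" for x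
      using assms(2) by (simp add: count_list_duplicate count_list_distinct count_list_0_iff)
  qed fact
qed

lemma strict_partition_iff: "strict_partition xs \<longleftrightarrow> is_partition xs \<and> distinct xs"
proof (induction xs)
  case (Cons x xs)
  have "strict_partition (x # xs) \<longleftrightarrow> 0 < x \<and> (\<forall>y\<in>set xs. y < x) \<and> strict_partition xs"
    by (auto simp: strict_partition_def)
  also have "\<dots> \<longleftrightarrow> 0 < x \<and> (\<forall>y\<in>set xs. y \<le> x) \<and> x \<notin> set xs \<and> strict_partition xs"
    by (metis less_irrefl order_le_less)
  finally show ?case using Cons.IH by (auto simp: is_partition_Cons)
qed (simp add: strict_partition_def is_partition_def)

lemma bij_betw_to_P: "bij_betw to_P strict_pairs P_set"
proof (rule bij_betw_imageI)
  show "inj_on to_P strict_pairs"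
  proof (rule inj_onI, clarify)
    fix xs ys xs' ys'
    assume "(xs, ys) \<in> strict_pairs" "(xs', ys') \<in> strict_pairs"
      and "to_P (xs, ys) = to_P (xs', ys')"
    then have strict: "strict_partition xs" "strict_partition ys"
        "strict_partition xs'" "strict_partition ys'"
      and eq: "duplicate xs = duplicate xs'" "map (\<lambda>j. 2 * j - 1) ys = map (\<lambda>j. 2 * j - 1) ys'"
      by (auto simp: strict_pairs_def to_P_def)
    have "set xs = set xs'" using eq(1) set_duplicate by metis
    moreover have "inj_on (\<lambda>j::nat. 2 * j - 1) (set ys \<union> set ys')"
    proof (rule inj_onI)
      fix i j assume "i \<in> set ys \<union> set ys'" "j \<in> set ys \<union> set ys'" "2 * i - 1 = 2 * j - 1"
      moreover from this have "i \<noteq> 0" "j \<noteq> 0"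
        using strict unfolding strict_partition_def by (metis Un_iff)+
      ultimately show "i = j" by presburger
    qed
    ultimately show "xs = xs' \<and> ys = ys'"
      using strict eq(2) by (metis strict_partition_eqI map_inj_on)
  qed
  show "to_P ` strict_pairs = P_set"
  proof
    show "to_P ` strict_pairs \<subseteq> P_set"
    proof (rule image_subsetI, clarify)
      fix xs ys assume "(xs, ys) \<in> strict_pairs"
      then have xs: "strict_partition xs" and ys: "strict_partition ys"
        by (auto simp: strict_pairs_def)
      have "sorted_wrt (\<lambda>i j. 2 * i - 1 > 2 * j - 1) ys"
        by (rule sorted_wrt_mono_rel[of ys "(>)"]) (use ys in \<open>auto simp: strict_partition_def\<close>)
      moreover have "\<forall>j\<in>set ys. 2 * j - 1 \<noteq> 0"
      proof
        fix j assume "j \<in> set ys"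
        then have "0 < j" using ys by (auto simp: strict_partition_def intro: gr0I)
        then show "2 * j - 1 \<noteq> 0" by linarith
      qed
      ultimately have "strict_partition (map (\<lambda>j. 2 * j - 1) ys)"
        using ys by (auto simp: strict_partition_def sorted_wrt_map)
      then have "is_partition (map (\<lambda>j. 2 * j - 1) ys)" "distinct (map (\<lambda>j. 2 * j - 1) ys)"
        by (auto simp only: strict_partition_iff)
      moreover have "\<forall>x\<in>set ys. odd (2 * x - 1)"
        using ys by (auto simp: strict_partition_def intro: gr0I)
      ultimately show "to_P (xs, ys) \<in> P_set"
        using xs by (simp add: P_set_def to_P_def count_list_duplicate count_list_distinct
            strict_partition_distinct is_partition_duplicate strict_partition_imp_is_partition)
    qed
    show "P_set \<subseteq> to_P ` strict_pairs"
    proof clarify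
      fix \<mu> \<beta> assume "(\<mu>, \<beta>) \<in> P_set"
      then have \<mu>: "is_partition \<mu>" "\<forall>x\<in>set \<mu>. count_list \<mu> x = 2"
        and \<beta>: "strict_partition \<beta>" "\<forall>x\<in>set \<beta>. odd x"
        by (auto simp: P_set_def strict_partition_iff)
      obtain xs where xs: "strict_partition xs" "duplicate xs = \<mu>"
        using \<mu> by (rule duplicate_surj)
      let ?ys = "map (\<lambda>x. (x + 1) div 2) \<beta>"
      have "sorted_wrt (\<lambda>x y. (x + 1) div 2 > (y + 1) div 2) \<beta>"
      proof (rule sorted_wrt_mono_rel[of \<beta> "(>)"])
        fix x y assume "x \<in> set \<beta>" "y \<in> set \<beta>" "x > y"
        moreover from this have "odd x" "odd y" using \<beta>(2) by auto
        ultimately show "(x + 1) div 2 > (y + 1) div 2" by presburger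
      qed (use \<beta>(1) in \<open>simp add: strict_partition_def\<close>)
      then have "strict_partition ?ys"
        using \<beta> by (auto simp: strict_partition_def sorted_wrt_map elim!: oddE)
      moreover have "map (\<lambda>j. 2 * j - 1) ?ys = \<beta>"
        using \<beta>(2) by (auto intro!: map_idI elim!: oddE)
      ultimately show "(\<mu>, \<beta>) \<in> to_P ` strict_pairs"
        using xs by (intro image_eqI[of _ _ "(xs, ?ys)"]) (auto simp: to_P_def strict_pairs_def)
    qed
  qed
qed

section \<open>Pairs of strict partitions and \<open>C_set\<close>\<close>

definition count_above :: "nat set \<Rightarrow> nat \<Rightarrow> nat" where
  "count_above J k = card {j \<in> J. k < j}"

lemma count_above_Suc:
  assumes "finite J"
  shows "count_above J k = count_above J (Suc k) + of_bool (Suc k \<in> J)"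
proof (cases "Suc k \<in> J")
  case True
  then have "{j \<in> J. k < j} = insert (Suc k) {j \<in> J. Suc k < j}" by auto
  then show ?thesis using assms True by (simp add: count_above_def)
next
  case False
  then have "{j \<in> J. k < j} = {j \<in> J. Suc k < j}"
    by (intro Collect_cong) (metis Suc_lessD Suc_lessI)
  then show ?thesis using False by (simp add: count_above_def)
qed

lemma sum_count_above:
  assumes "J \<subseteq> {1..N}"
  shows "(\<Sum>k=1..N. count_above J k) = (\<Sum>j\<in>J. j - 1)"
proof -
  have "finite J" using assms finite_subset by blast
  have "(\<Sum>k=1..N. count_above J k) = (\<Sum>k=1..N. \<Sum>j\<in>J. if k < j then 1 else 0)"
    using \<open>finite J\<close> by (simp add: count_above_def sum.If_cases Int_def conj_commute)
  also have "\<dots> = (\<Sum>j\<in>J. \<Sum>k=1..N. if k < j then 1 else 0)"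
    by (rule sum.swap)
  also have "\<dots> = (\<Sum>j\<in>J. j - 1)"
  proof (rule sum.cong)
    fix j assume "j \<in> J"
    then have "{1..N} \<inter> {k. k < j} = {1..<j}" using assms by auto
    then show "(\<Sum>k=1..N. if k < j then 1 else 0) = j - 1" by (simp add: sum.If_cases)
  qed simp
  finally show ?thesis .
qed

definition b_part :: "nat list \<Rightarrow> nat set \<Rightarrow> nat \<Rightarrow> nat" where
  "b_part xs J k = part xs k + count_above J k"

definition a_part :: "nat list \<Rightarrow> nat set \<Rightarrow> nat \<Rightarrow> nat" where
  "a_part xs J k = b_part xs J k + of_bool (k \<in> J)"

definition to_C :: "nat list \<times> nat list \<Rightarrow> nat list \<times> nat list" where
  "to_C = (\<lambda>(xs, ys). (list_of_parts (a_part xs (set ys)), list_of_parts (b_part xs (set ys))))"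

lemma b_part_ge_a_part_Suc:
  assumes "is_partition xs" "finite J" "1 \<le> k"
  shows "a_part xs J (Suc k) \<le> b_part xs J k"
  using part_antimono[of xs k "Suc k"] count_above_Suc[of J k] assms
  by (simp add: a_part_def b_part_def)

lemma a_part_bounded:
  assumes "finite J"
  obtains N where "length xs \<le> N" "J \<subseteq> {..N}" "\<And>k. N < k \<Longrightarrow> a_part xs J k = 0"
proof
  let ?N = "max (length xs) (Max (insert 0 J))"
  have le: "j \<le> ?N" if "j \<in> J" for j
    using assms that by (simp add: le_max_iff_disj)
  show "length xs \<le> ?N" by simp
  show "J \<subseteq> {..?N}" using le by auto
  show "a_part xs J k = 0" if "?N < k" for k
  proof -
    have "\<not> k \<le> j" if "j \<in> J" for j
      using le[OF that] \<open>?N < k\<close> by linarith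
    then have "{j \<in> J. k < j} = {}" "k \<notin> J" by (auto dest: less_imp_le)
    then have "count_above J k = 0" "k \<notin> J" unfolding count_above_def by (metis card.empty)+
    then show ?thesis using that by (simp add: a_part_def b_part_def part_def)
  qed
qed

lemma to_C_parts:
  assumes "(xs, ys) \<in> strict_pairs" "to_C (xs, ys) = (l1, l2)"
  shows "is_partition l1" "is_partition l2"
    and "1 \<le> k \<Longrightarrow> part l1 k = a_part xs (set ys) k"
    and "1 \<le> k \<Longrightarrow> part l2 k = b_part xs (set ys) k"
proof -
  let ?a = "a_part xs (set ys)" and ?b = "b_part xs (set ys)"
  have xs: "is_partition xs"
    using assms by (auto simp: strict_pairs_def strict_partition_imp_is_partition)
  have ba: "?b k \<le> ?a k" for k by (simp add: a_part_def)
  have ab: "?a (Suc k) \<le> ?b k" if "1 \<le> k" for k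
    using b_part_ge_a_part_Suc[OF xs _ that] by simp
  obtain N where N: "\<And>k. N < k \<Longrightarrow> ?a k = 0"
    by (rule a_part_bounded[of "set ys" xs]) auto
  have l: "l1 = list_of_parts ?a" "l2 = list_of_parts ?b"
    using assms(2) by (auto simp: to_C_def)
  have a_mono: "?a (Suc k) \<le> ?a k" if "1 \<le> k" for k
    using ab[OF that] ba[of k] by linarith
  have b_mono: "?b (Suc k) \<le> ?b k" if "1 \<le> k" for k
    using ab[OF that] ba[of "Suc k"] by linarith
  have b_0: "?b k = 0" if "N < k" for k
    using N[OF that] ba[of k] by linarith
  show "is_partition l1" "1 \<le> k \<Longrightarrow> part l1 k = ?a k"
    unfolding l using list_of_parts[of ?a N, OF a_mono N] by simp_all
  show "is_partition l2" "1 \<le> k \<Longrightarrow> part l2 k = ?b k"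
    unfolding l using list_of_parts[of ?b N, OF b_mono b_0] by simp_all
qed

lemma to_C_in_C_set:
  assumes "(xs, ys) \<in> strict_pairs"
  shows "to_C (xs, ys) \<in> C_set"
proof -
  obtain l1 l2 where L: "to_C (xs, ys) = (l1, l2)" by fastforce
  note p = to_C_parts[OF assms L]
  let ?J = "set ys" and ?N = "num_pairs (l1, l2)"
  have xs: "strict_partition xs" and ys: "strict_partition ys"
    using assms by (auto simp: strict_pairs_def)
  note px = strict_partition_imp_is_partition[OF xs]
  have le_N: "k \<le> ?N" if "1 \<le> k" "0 < a_part xs ?J k" for k
    using part_pos_iff[OF p(1) that(1)] p(3) that by (simp add: num_pairs_def le_max_iff_disj)
  have "k \<in> J_set (l1, l2) \<longleftrightarrow> k \<in> ?J" for k
  proof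
    assume "k \<in> ?J"
    then have "1 \<le> k" using ys unfolding strict_partition_def by (metis less_one not_le)
    then show "k \<in> J_set (l1, l2)"
      using \<open>k \<in> ?J\<close> le_N[of k] p(3,4)[of k]
      by (auto simp: J_set_def a_entry_def b_entry_def a_part_def)
  qed (use p(3,4) in \<open>auto simp: J_set_def a_entry_def b_entry_def a_part_def\<close>)
  then have J: "J_set (l1, l2) = ?J" by blast
  have r: "r_entry (l1, l2) k = int (part xs k)" if "1 \<le> k" for k
    using p(4)[OF that] by (simp add: r_entry_def b_entry_def S_count_def J b_part_def count_above_def)
  have "part l2 (k + 1) \<le> part l1 k \<and> part l1 (k + 1) \<le> part l2 k" if "1 \<le> k" for k
    using b_part_ge_a_part_Suc[OF px, of ?J k] p(3,4)[of k] p(3,4)[of "k + 1"] that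
    by (simp add: a_part_def)
  then have "cylindric_partition_11 (l1, l2)"
    using p(1,2) by (auto simp: cylindric_partition_11_def)
  moreover have "\<forall>k\<in>{1..?N}. a_entry (l1, l2) k - b_entry (l1, l2) k \<in> {0, 1}"
    using p(3,4) by (auto simp: a_entry_def b_entry_def a_part_def)
  moreover have "length xs \<le> ?N"
  proof (cases "xs = []")
    case False
    then have "1 \<le> length xs" by (cases xs) auto
    moreover from this have "0 < part xs (length xs)" using part_pos_iff[OF px] by blast
    ultimately show ?thesis by (intro le_N) (auto simp: a_part_def b_part_def)
  qed simp
  moreover have "\<forall>k\<in>{1..<length xs}. r_entry (l1, l2) k > r_entry (l1, l2) (k + 1)"
  proof
    fix k assume "k \<in> {1..<length xs}"
    then show "r_entry (l1, l2) k > r_entry (l1, l2) (k + 1)"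
      using xs sorted_wrt_nth_less[of "(>)" xs "k - 1" k] r
      by (auto simp: strict_partition_def part_def)
  qed
  moreover have "1 \<le> length xs \<longrightarrow> r_entry (l1, l2) (length xs) > 0"
    using r part_pos_iff[OF px] by auto
  moreover have "\<forall>k. length xs < k \<and> k \<le> ?N \<longrightarrow> r_entry (l1, l2) k = 0"
    using r by (auto simp: part_def)
  ultimately show ?thesis unfolding L C_set_def by blast
qed

lemma weight_to_C:
  assumes "(xs, ys) \<in> strict_pairs" "to_P (xs, ys) = (\<mu>, \<beta>)"
  shows "weight (to_C (xs, ys)) = sum_list \<mu> + sum_list \<beta>"
proof -
  obtain l1 l2 where L: "to_C (xs, ys) = (l1, l2)" by fastforce
  note p = to_C_parts[OF assms(1) L]
  let ?J = "set ys"
  have ys: "strict_partition ys" using assms by (auto simp: strict_pairs_def)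
  obtain N where N: "length xs \<le> N" "?J \<subseteq> {..N}" "\<And>k. N < k \<Longrightarrow> a_part xs ?J k = 0"
    by (rule a_part_bounded[of ?J xs]) auto
  have J: "?J \<subseteq> {1..N}" using N(2) ys by (auto simp: strict_partition_def Suc_le_eq intro: gr0I)
  have len: "length l \<le> N"
    if "is_partition l" "\<And>k. 1 \<le> k \<Longrightarrow> part l k \<le> a_part xs ?J k" for l
  proof (rule ccontr)
    assume "\<not> length l \<le> N"
    then have "1 \<le> length l" "a_part xs ?J (length l) = 0" using N(3) by auto
    then show False
      using that(2)[of "length l"] part_pos_iff[OF that(1), of "length l"] by simp
  qed
  have len1: "length l1 \<le> N" using len[OF p(1)] p(3) by simp
  have len2: "length l2 \<le> N" using len[OF p(2)] p(4) by (simp add: a_part_def)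
  have "weight (to_C (xs, ys)) = (\<Sum>k=1..N. a_part xs ?J k) + (\<Sum>k=1..N. b_part xs ?J k)"
    using sum_list_eq_sum_part[OF len1] sum_list_eq_sum_part[OF len2] p(3,4)
    by (simp add: L weight_def)
  also have "\<dots> = 2 * (\<Sum>k=1..N. part xs k)
      + (2 * (\<Sum>k=1..N. count_above ?J k) + (\<Sum>k=1..N. of_bool (k \<in> ?J)))"
    by (simp add: a_part_def b_part_def sum.distrib)
  also have "(\<Sum>k=1..N. of_bool (k \<in> ?J)) = (\<Sum>j\<in>?J. 1::nat)"
    using J by (simp add: of_bool_def sum.If_cases Int_absorb1)
  also have "2 * (\<Sum>k=1..N. count_above ?J k) + (\<Sum>j\<in>?J. 1) = (\<Sum>j\<in>?J. 2 * (j - 1) + 1)"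
    unfolding sum_count_above[OF J] sum_distrib_left sum.distrib ..
  also have "\<dots> = (\<Sum>j\<in>?J. 2 * j - 1)"
    by (rule sum.cong) (use J in force)+
  also have "2 * (\<Sum>k=1..N. part xs k) = sum_list (duplicate xs)"
    by (simp add: sum_list_duplicate sum_list_eq_sum_part[OF N(1)])
  finally show ?thesis
    using assms(2) sum_list_strict_partition[OF ys, of "\<lambda>j. 2 * j - 1"] by (auto simp: to_P_def)
qed

lemma inj_on_to_C: "inj_on to_C strict_pairs"
proof (rule inj_onI, clarify)
  fix xs ys xs' ys'
  assume D: "(xs, ys) \<in> strict_pairs" and D': "(xs', ys') \<in> strict_pairs"
    and eq: "to_C (xs, ys) = to_C (xs', ys')"
  have strict: "strict_partition xs" "strict_partition ys" "strict_partition xs'" "strict_partition ys'"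
    using D D' by (auto simp: strict_pairs_def)
  obtain l1 l2 where L: "to_C (xs, ys) = (l1, l2)" by fastforce
  note p = to_C_parts[OF D L] and p' = to_C_parts[OF D' eq[symmetric, unfolded L]]
  have ab: "a_part xs (set ys) k = a_part xs' (set ys') k"
      "b_part xs (set ys) k = b_part xs' (set ys') k" if "1 \<le> k" for k
    using p(3,4)[OF that] p'(3,4)[OF that] by simp_all
  have "k \<in> set ys \<longleftrightarrow> k \<in> set ys'" for k
  proof (cases "1 \<le> k")
    case True
    then have "(of_bool (k \<in> set ys) :: nat) = of_bool (k \<in> set ys')"
      using ab[OF True] by (simp add: a_part_def)
    then show ?thesis by (simp only: of_bool_eq_iff)
  next
    case False
    then have "k = 0" by simp
    then show ?thesis using strict by (simp add: strict_partition_def)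
  qed
  then have J: "set ys = set ys'" by blast
  have "xs = xs'"
  proof (rule partition_eqI)
    show "part xs k = part xs' k" if "1 \<le> k" for k
      using ab[OF that] by (simp add: b_part_def J)
  qed (use strict in \<open>simp_all add: strict_partition_imp_is_partition\<close>)
  moreover have "ys = ys'"
    using strict(2,4) J by (rule strict_partition_eqI)
  ultimately show "xs = xs' \<and> ys = ys'" ..
qed

lemma C_set_subset_range_to_C:
  assumes "L \<in> C_set"
  shows "L \<in> to_C ` strict_pairs"
proof -
  obtain l1 l2 where L: "L = (l1, l2)" by fastforce
  let ?N = "num_pairs L"
  have part: "is_partition l1" "is_partition l2"
    using assms by (auto simp: C_set_def L cylindric_partition_11_def)
  have ab: "a_entry L k - b_entry L k \<in> {0, 1}" if "1 \<le> k" "k \<le> ?N" for k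
    using assms that by (auto simp: C_set_def)
  obtain t where t: "t \<le> ?N" "\<And>k. k \<in> {1..<t} \<Longrightarrow> r_entry L k > r_entry L (k + 1)"
      "1 \<le> t \<Longrightarrow> r_entry L t > 0" "\<And>k. t < k \<Longrightarrow> k \<le> ?N \<Longrightarrow> r_entry L k = 0"
    using assms unfolding C_set_def by blast
  let ?J = "J_set L"
  have J: "?J \<subseteq> {1..?N}" by (auto simp: J_set_def)
  then have fin: "finite ?J" using finite_subset by blast
  have zero: "part l1 k = 0" "part l2 k = 0" if "?N < k" for k
    using that by (auto simp: L num_pairs_def part_def)
  define xs where "xs = map (\<lambda>k. nat (r_entry L k)) [1..<Suc t]"
  have len: "length xs = t" by (simp add: xs_def)
  have decr: "r_entry L j < r_entry L i" if "1 \<le> i" "i < j" "j \<le> t" for i j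
    using that(2,3)
  proof (induction j)
    case (Suc j)
    then show ?case using t(2)[of j] that(1) by (cases "i = j") auto
  qed simp
  have pos: "0 < r_entry L k" if "1 \<le> k" "k \<le> t" for k
    using that t(3) decr[of k t] by (cases "k = t") auto
  have xs: "strict_partition xs"
  proof -
    have "sorted_wrt (>) xs"
      using decr pos by (auto simp: xs_def sorted_wrt_iff_nth_less simp del: upt_Suc)
    moreover have "0 < x" if "x \<in> set xs" for x
      using that pos by (auto simp: xs_def simp del: upt_Suc)
    ultimately show ?thesis by (auto simp: strict_partition_def)
  qed
  have r: "int (part xs k) = r_entry L k" if "1 \<le> k" for k
  proof (cases "k \<le> t")
    case True
    then show ?thesis
      using that pos[OF that True] len by (auto simp: part_def xs_def simp del: upt_Suc)
  next
    case False
    have "S_count L k = 0" if "?N < k"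
    proof -
      have "{j \<in> ?J. k < j} = {}" using J that by auto
      then show ?thesis unfolding S_count_def by (metis card.empty)
    qed
    then have "r_entry L k = 0"
      using t(4)[of k] False zero(2)[of k]
      by (cases "k \<le> ?N") (auto simp: r_entry_def b_entry_def L)
    then show ?thesis using False len by (simp add: part_def)
  qed
  define ys where "ys = rev (sorted_list_of_set ?J)"
  have ys: "strict_partition ys" "set ys = ?J"
    using J fin unfolding ys_def by (auto intro!: strict_partition_rev_sorted_list_of_set)
  have D: "(xs, ys) \<in> strict_pairs" using xs ys by (simp add: strict_pairs_def)
  obtain m1 m2 where M: "to_C (xs, ys) = (m1, m2)" by fastforce
  note p = to_C_parts[OF D M]
  have b: "b_part xs ?J k = part l2 k" if "1 \<le> k" for k
    using r[OF that] by (simp add: b_part_def r_entry_def b_entry_def S_count_def count_above_def L)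
  have a: "a_part xs ?J k = part l1 k" if "1 \<le> k" for k
  proof (cases "k \<le> ?N")
    case True
    then show ?thesis
      using ab[OF that True] b[OF that] that
      by (auto simp: a_part_def J_set_def a_entry_def b_entry_def L)
  next
    case False
    then show ?thesis
      using zero[of k] b[OF that] J by (auto simp: a_part_def)
  qed
  have "m1 = l1" "m2 = l2"
    using part p a b ys(2) by (auto intro: partition_eqI)
  then show ?thesis using D M L by (metis image_eqI)
qed

lemma bij_betw_to_C: "bij_betw to_C strict_pairs C_set"
  using inj_on_to_C to_C_in_C_set C_set_subset_range_to_C
  by (intro bij_betw_imageI) auto

section \<open>The bijection\<close>

theorem theorem5:
  shows "\<exists>\<Phi>. bij_betw \<Phi> C_set P_set \<and>
    (\<forall>L\<in>C_set. \<forall>\<mu> \<beta>. \<Phi> L = (\<mu>, \<beta>) \<longrightarrow> weight L = sum_list \<mu> + sum_list \<beta>)"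
proof (intro exI conjI ballI allI impI)
  let ?inv = "inv_into strict_pairs to_C"
  show "bij_betw (to_P \<circ> ?inv) C_set P_set"
    using bij_betw_inv_into[OF bij_betw_to_C] bij_betw_to_P by (rule bij_betw_trans)
  fix L \<mu> \<beta> assume L: "L \<in> C_set" and \<Phi>: "(to_P \<circ> ?inv) L = (\<mu>, \<beta>)"
  obtain xs ys where D: "(xs, ys) \<in> strict_pairs" "to_C (xs, ys) = L"
    using L bij_betw_to_C unfolding bij_betw_def by (metis imageE surj_pair)
  then have "?inv L = (xs, ys)"
    using inv_into_f_f[OF inj_on_to_C] by blast
  then show "weight L = sum_list \<mu> + sum_list \<beta>"
    using weight_to_C[OF D(1)] \<Phi> D(2) by auto
qed

end
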